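(* (Improved subdivision gadget.) Let $\mathcal{H}_{\rm targ}=\mathcal{H}_{\rm else}+\alpha\,A\otimes B$ be a Hamiltonian on $n$ qubits, where $\alpha\in\mathbb{R}$, $\mathcal{H}_{\rm else}$ is an arbitrary Hermitian operator on the $n$ qubits, and $A,B$ are Hermitian operators acting on disjoint sets of qubits with $\|A\|=\|B\|=1$. Add one slack qubit $w$, and for $\epsilon>0$ and $\Delta>0$ let $\widetilde{\mathcal{H}}=\Delta|1\rangle\langle1|_w+V$ with $$V=\mathcal{H}_{\rm else}+\frac{|\alpha|}{2}(A^2+B^2)\otimes|0\rangle\langle0|_w+\sqrt{\frac{|\alpha|\Delta}{2}}\,\bigl(\mathrm{sgn}(\alpha)A-B\bigr)\otimes X_w .$$ If $$\Delta\ge\Bigl(\frac{2|\alpha|}{\epsilon}+1\Bigr)\bigl(2\|\mathcal{H}_{\rm else}\|+|\alpha|+\epsilon\bigr),$$ then the lowest $2^n$ eigenvalues of $\widetilde{\mathcal{H}}$ are $\epsilon$-close to the spectrum of $\mathcal{H}_{\rm targ}$: for $j=1,\dots,2^n$ the $j$-th smallest eigenvalue of $\widetilde{\mathcal{H}}$ differs from the $j$-th smallest eigenvalue of $\mathcal{H}_{\rm targ}$ by at most $\epsilon$.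
   Context: $\|\cdot\|$ is the operator norm. $X_w$ is the Pauli $X$ matrix on the slack qubit. Operators on a subset of the qubits are tensored with the identity on the others, and $A$, $B$ in sums such as $\mathrm{sgn}(\alpha)A-B$ stand for $A\otimes\mathbb{1}$ and $\mathbb{1}\otimes B$. Eigenvalues are counted with multiplicity. *)

theory Defs
  imports "HOL-Analysis.Analysis" "HOL-Computational_Algebra.Computational_Algebra"
begin

text \<open>
  The qubits are the elements of a finite type \<open>'q\<close>, so \<open>n = CARD('q)\<close>. A computational basis
  state is identified with the set of qubits that are in state 1; the operators on all \<open>n\<close> qubits
  are then the \<open>2^n \<times> 2^n\<close> matrices indexed by \<open>'q set\<close>.
\<close>

type_synonym 'i cmatrix = "complex ^ 'i ^ 'i"

text \<open>
  Matrix elements of an operator on a subset \<open>S\<close> of the qubits, whose basis states are the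
  subsets of \<open>S\<close>. Only the values at arguments contained in \<open>S\<close> are meaningful, and
  \<open>extend S\<close> and \<open>local_tensor S T\<close> below read no others.
\<close>

type_synonym 'q local_op = "'q set \<Rightarrow> 'q set \<Rightarrow> complex"

text \<open>The operator on \<open>S\<close> tensored with the identity on the qubits outside \<open>S\<close>.\<close>

definition extend :: "'q::finite set \<Rightarrow> 'q local_op \<Rightarrow> 'q set cmatrix" where
  "extend S A = (\<chi> x y. if x - S = y - S then A (x \<inter> S) (y \<inter> S) else 0)"

text \<open>The tensor product of operators on disjoint \<open>S\<close> and \<open>T\<close>, an operator on \<open>S \<union> T\<close>.\<close>

definition local_tensor ::
  "'q set \<Rightarrow> 'q set \<Rightarrow> 'q local_op \<Rightarrow> 'q local_op \<Rightarrow> 'q local_op" where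
  "local_tensor S T A B = (\<lambda>x y. A (x \<inter> S) (y \<inter> S) * B (x \<inter> T) (y \<inter> T))"

text \<open>
  Tensor product with an operator on one further qubit, whose basis states 0 and 1 are
  \<open>False\<close> and \<open>True\<close>.
\<close>

definition tensor_slack ::
  "('i::finite) cmatrix \<Rightarrow> bool cmatrix \<Rightarrow> ('i \<times> bool) cmatrix" (infix "\<otimes>\<^sub>w" 72) where
  "M \<otimes>\<^sub>w P = (\<chi> r c. M $ fst r $ fst c * P $ snd r $ snd c)"

definition proj0 :: "bool cmatrix" where
  "proj0 = (\<chi> r c. if \<not> r \<and> \<not> c then 1 else 0)"

definition proj1 :: "bool cmatrix" where
  "proj1 = (\<chi> r c. if r \<and> c then 1 else 0)"

definition pauli_X :: "bool cmatrix" where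
  "pauli_X = (\<chi> r c. if r \<noteq> c then 1 else 0)"

definition hermitian :: "('i::finite) cmatrix \<Rightarrow> bool" where
  "hermitian M \<longleftrightarrow> (\<forall>i j. M $ j $ i = cnj (M $ i $ j))"

definition op_norm :: "('i::finite) cmatrix \<Rightarrow> real" where
  "op_norm M = onorm (\<lambda>v. M *v v)"

definition char_polynomial :: "('i::finite) cmatrix \<Rightarrow> complex poly" where
  "char_polynomial M = det (mat [:0, 1:] - (\<chi> i j. [:M $ i $ j:]))"

text \<open>
  The eigenvalues in increasing order, repeated according to multiplicity. Only meant for
  Hermitian matrices, for which \<open>Re\<close> loses nothing and algebraic and geometric multiplicities agree.
\<close>

definition eigenvalues :: "('i::finite) cmatrix \<Rightarrow> real list" where
  "eigenvalues M = sorted_list_of_multiset (image_mset Re (proots (char_polynomial M)))"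

definition nth_smallest_eigenvalue :: "nat \<Rightarrow> ('i::finite) cmatrix \<Rightarrow> real" where
  "nth_smallest_eigenvalue j M = eigenvalues M ! (j - 1)"

definition H_target ::
  "'q set cmatrix \<Rightarrow> real \<Rightarrow> 'q::finite set \<Rightarrow> 'q set \<Rightarrow> 'q local_op \<Rightarrow> 'q local_op \<Rightarrow> 'q set cmatrix"
  where
  "H_target H_else \<alpha> S T A B = H_else + \<alpha> *\<^sub>R extend (S \<union> T) (local_tensor S T A B)"

definition gadget_V ::
  "'q set cmatrix \<Rightarrow> real \<Rightarrow> real \<Rightarrow> 'q::finite set \<Rightarrow> 'q set \<Rightarrow> 'q local_op \<Rightarrow> 'q local_op \<Rightarrow>
    ('q set \<times> bool) cmatrix" where
  "gadget_V H_else \<alpha> \<Delta> S T A B =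
     H_else \<otimes>\<^sub>w mat 1
     + (\<bar>\<alpha>\<bar> / 2) *\<^sub>R ((extend S A ** extend S A + extend T B ** extend T B) \<otimes>\<^sub>w proj0)
     + sqrt (\<bar>\<alpha>\<bar> * \<Delta> / 2) *\<^sub>R ((sgn \<alpha> *\<^sub>R extend S A - extend T B) \<otimes>\<^sub>w pauli_X)"

definition H_gadget ::
  "'q set cmatrix \<Rightarrow> real \<Rightarrow> real \<Rightarrow> 'q::finite set \<Rightarrow> 'q set \<Rightarrow> 'q local_op \<Rightarrow> 'q local_op \<Rightarrow>
    ('q set \<times> bool) cmatrix" where
  "H_gadget H_else \<alpha> \<Delta> S T A B =
     \<Delta> *\<^sub>R (mat 1 \<otimes>\<^sub>w proj1) + gadget_V H_else \<alpha> \<Delta> S T A B"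

end

theory Submission
  imports Defs
begin

text \<open>
  Completing the square in the slack amplitude \<open>u\<close> shows that the quadratic form of the gadget at
  \<open>(v, u)\<close> is \<open>\<langle>v, H\<^sub>t\<^sub>a\<^sub>r\<^sub>g v\<rangle> + \<langle>u, H\<^sub>e\<^sub>l\<^sub>s\<^sub>e u\<rangle> + \<Delta> \<parallel>u + C v / \<Delta>\<parallel>\<^sup>2\<close>, where \<open>C\<close> is the coupling and
  \<open>\<parallel>C\<parallel>\<^sup>2 \<le> 2 |\<alpha>| \<Delta>\<close>. The trial vectors \<open>(v, - C v / \<Delta>)\<close> bound the gadget eigenvalues from above;
  the projection \<open>(v, u) \<mapsto> v\<close> maps low-energy vectors of the gadget to low-energy vectors of the
  target, which bounds them from below. Both comparisons are dimension counts, so the Courant-Fischer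
  theorem is not needed, only an orthonormal eigenbasis.
\<close>

section \<open>Complex inner products and adjoints\<close>

text \<open>Linear in the first argument and conjugate-linear in the second. The library product
  \<open>\<bullet>\<close> on complex vectors is only the real part of this one, and orthonormality
  of complex eigenvectors needs the imaginary part as well.\<close>

definition cinner :: "complex ^ 'n \<Rightarrow> complex ^ 'n::finite \<Rightarrow> complex" where
  "cinner x y = (\<Sum>i\<in>UNIV. x $ i * cnj (y $ i))"

lemma inner_complex_eq_Re: "(z::complex) \<bullet> w = Re (z * cnj w)"
  by (simp add: inner_complex_def)

lemma inner_vec_eq_Re_cinner: "x \<bullet> y = Re (cinner x y)"
  by (simp add: inner_vec_def cinner_def inner_complex_eq_Re)

lemma cinner_add_left: "cinner (x + y) z = cinner x z + cinner y z"
  by (simp add: cinner_def sum.distrib algebra_simps)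

lemma cinner_scale_left: "cinner (c *s x) y = c * cinner x y"
  by (simp add: cinner_def sum_distrib_left algebra_simps)

lemma cinner_scale_right: "cinner x (c *s y) = cnj c * cinner x y"
  by (simp add: cinner_def sum_distrib_left algebra_simps)

lemma cinner_commute: "cinner y x = cnj (cinner x y)"
  by (simp add: cinner_def mult.commute)

lemma cinner_self: "cinner x x = of_real ((norm x)\<^sup>2)"
proof -
  have "Im (cinner x x) = 0"
    using cinner_commute[of x x] by (metis cnj.sel(2) neg_equal_zero)
  moreover have "Re (cinner x x) = (norm x)\<^sup>2"
    by (metis inner_vec_eq_Re_cinner power2_norm_eq_inner)
  ultimately show ?thesis
    by (simp add: complex_eq_iff)
qed

definition adjoint_matrix :: "('n::finite) cmatrix \<Rightarrow> 'n cmatrix" where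
  "adjoint_matrix M = (\<chi> i j. cnj (M $ j $ i))"

lemma hermitian_iff_adjoint: "hermitian M \<longleftrightarrow> adjoint_matrix M = M"
  unfolding hermitian_def adjoint_matrix_def vec_eq_iff vec_lambda_beta by metis

lemma cinner_matrix_vector: "cinner (M *v x) y = cinner x (adjoint_matrix M *v y)"
proof -
  have "cinner (M *v x) y = (\<Sum>i\<in>UNIV. \<Sum>j\<in>UNIV. M $ i $ j * x $ j * cnj (y $ i))"
    by (simp add: cinner_def matrix_vector_mult_def sum_distrib_right)
  also have "\<dots> = (\<Sum>j\<in>UNIV. \<Sum>i\<in>UNIV. M $ i $ j * x $ j * cnj (y $ i))"
    by (rule sum.swap)
  also have "\<dots> = cinner x (adjoint_matrix M *v y)"
    by (simp add: cinner_def matrix_vector_mult_def adjoint_matrix_def sum_distrib_left algebra_simps)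
  finally show ?thesis .
qed

lemma inner_matrix_vector:
  fixes M :: "('n::finite) cmatrix"
  shows "(M *v x) \<bullet> y = x \<bullet> (adjoint_matrix M *v y)"
  by (simp add: inner_vec_eq_Re_cinner cinner_matrix_vector)

lemma hermitian_cinner: "hermitian M \<Longrightarrow> cinner (M *v x) y = cinner x (M *v y)"
  by (simp add: cinner_matrix_vector hermitian_iff_adjoint)

lemma hermitian_inner:
  fixes M :: "('n::finite) cmatrix"
  shows "hermitian M \<Longrightarrow> (M *v x) \<bullet> y = x \<bullet> (M *v y)"
  by (simp add: inner_matrix_vector hermitian_iff_adjoint)

lemma scaleR_eq_scale: "r *\<^sub>R (x :: complex ^ 'n) = of_real r *s x"
  unfolding vec_eq_iff by (simp add: scaleR_conv_of_real[where 'a = complex])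

lemma matrix_vector_scaleR:
  fixes M :: "complex ^ 'n ^ 'm"
  shows "M *v (r *\<^sub>R x) = r *\<^sub>R (M *v x)"
  by (simp add: scaleR_eq_scale vector_scalar_commute)

lemma scaleR_matrix_vector:
  fixes M :: "complex ^ 'n ^ 'm"
  shows "(r *\<^sub>R M) *v x = r *\<^sub>R (M *v x)"
  by (simp add: vec_eq_iff matrix_vector_mult_def scaleR_sum_right)

lemma norm_matrix_vector_le: "norm (M *v x) \<le> op_norm M * norm x"
  unfolding op_norm_def by (rule onorm[OF matrix_vector_mul_bounded_linear])

lemma op_norm_nonneg: "0 \<le> op_norm M"
  unfolding op_norm_def by (rule onorm_pos_le[OF matrix_vector_mul_bounded_linear])

lemma abs_quadratic_form_le: "\<bar>x \<bullet> (M *v x)\<bar> \<le> op_norm M * (norm x)\<^sup>2"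
proof -
  have "\<bar>x \<bullet> (M *v x)\<bar> \<le> norm x * norm (M *v x)"
    by (rule Cauchy_Schwarz_ineq2)
  also have "\<dots> \<le> norm x * (op_norm M * norm x)"
    by (intro mult_left_mono norm_matrix_vector_le) simp
  finally show ?thesis
    by (simp add: power2_eq_square algebra_simps)
qed

section \<open>The spectral theorem for Hermitian matrices\<close>

text \<open>A maximizer \<open>x\<close> of the Rayleigh quotient on the compact unit sphere of
  \<open>W\<close> is an eigenvector: with \<open>l\<close> the maximum, the form of
  \<open>p = l - M\<close> is nonnegative on \<open>W\<close> and vanishes at \<open>x\<close>,
  which forces \<open>p x = 0\<close>. The subspace \<open>W\<close> is a real one.\<close>

lemma hermitian_eigenvector_in_subspace:
  fixes M :: "('n::finite) cmatrix"
  assumes M: "hermitian M" and W: "subspace W" and inv: "\<And>x. x \<in> W \<Longrightarrow> M *v x \<in> W"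
    and nz: "y \<in> W" "y \<noteq> 0"
  obtains x l where "x \<in> W" "norm x = 1" "M *v x = (l::real) *\<^sub>R x"
proof -
  let ?K = "W \<inter> sphere 0 1"
  have "compact ?K"
    using closed_subspace[OF W] by (simp add: closed_Int_compact)
  moreover have "(1 / norm y) *\<^sub>R y \<in> ?K"
    using nz W by (simp add: subspace_scale)
  moreover have "continuous_on ?K (\<lambda>x. x \<bullet> (M *v x))"
    by (intro continuous_intros bounded_linear.continuous_on[OF matrix_vector_mul_bounded_linear])
  ultimately obtain x where x: "x \<in> ?K" and
    max: "\<And>z. z \<in> ?K \<Longrightarrow> z \<bullet> (M *v z) \<le> x \<bullet> (M *v x)"
    using continuous_attains_sup[of ?K "\<lambda>x. x \<bullet> (M *v x)"] by blast
  define l where "l = x \<bullet> (M *v x)"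
  define p where "p z = l *\<^sub>R z - M *v z" for z
  have xx: "norm x = 1" "x \<in> W" using x by auto
  have p_nonneg: "0 \<le> z \<bullet> p z" if "z \<in> W" for z
  proof (cases "z = 0")
    case False
    have "(1 / norm z) *\<^sub>R z \<in> ?K"
      using that False W by (simp add: subspace_scale)
    from max[OF this] have "(z \<bullet> (M *v z)) / (norm z)\<^sup>2 \<le> l"
      by (simp add: matrix_vector_scaleR l_def power2_eq_square)
    then show ?thesis
      using False by (simp add: p_def inner_diff_right field_simps power2_norm_eq_inner)
  qed (simp add: p_def)
  have px: "p x \<in> W"
    using xx W inv by (simp add: p_def subspace_diff subspace_scale)
  have p_sym: "p a \<bullet> b = a \<bullet> p b" for a b
    by (simp add: p_def inner_diff_left inner_diff_right hermitian_inner[OF M])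
  have p_lin: "p (a + t *\<^sub>R b) = p a + t *\<^sub>R p b" for a b t
    by (simp add: p_def matrix_vector_right_distrib matrix_vector_scaleR algebra_simps)
  have pxx: "x \<bullet> p x = 0"
    using xx by (simp add: p_def inner_diff_right l_def flip: power2_norm_eq_inner)
  \<comment> \<open>Nonnegativity of the form along the line through \<open>x\<close> in direction
    \<open>p x\<close>; the linear coefficient is \<open>2 (norm (p x))\<^sup>2\<close>, so a small
    negative \<open>t\<close> violates it unless \<open>p x = 0\<close>.\<close>
  have quad: "0 \<le> 2 * t * (norm (p x))\<^sup>2 + t\<^sup>2 * (p x \<bullet> p (p x))" for t
  proof -
    have "0 \<le> (x + t *\<^sub>R p x) \<bullet> p (x + t *\<^sub>R p x)"
      using xx px W by (intro p_nonneg) (simp add: subspace_add subspace_scale)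
    also have "\<dots> = 2 * t * (norm (p x))\<^sup>2 + t\<^sup>2 * (p x \<bullet> p (p x))"
      using pxx p_sym[of x x] p_sym[of x "p x"]
      by (simp add: p_lin inner_add_left inner_add_right dot_square_norm power2_eq_square[of t]
          algebra_simps)
    finally show ?thesis .
  qed
  have "p x = 0"
  proof (rule ccontr)
    assume "p x \<noteq> 0"
    then have a: "0 < (norm (p x))\<^sup>2" (is "0 < ?a") by simp
    define q where "q = p x \<bullet> p (p x)"
    have q: "0 \<le> q" unfolding q_def using p_nonneg px by blast
    \<comment> \<open>The denominator \<open>q + 1\<close> stays positive even for
      \<open>q = 0\<close>, and \<open>t\<close> is close enough to 0 for the linear term to
      dominate.\<close>
    define t where "t = - ?a / (q + 1)"
    have "t * (2 * ?a + t * q) \<ge> 0"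
      using quad[of t] by (simp add: q_def power2_eq_square algebra_simps)
    moreover have "t < 0" unfolding t_def using a q by (simp add: field_simps)
    moreover have "2 * ?a + t * q = ?a * (q + 2) / (q + 1)"
      unfolding t_def using q by (simp add: field_simps)
    then have "2 * ?a + t * q > 0" using a q by simp
    ultimately show False by (simp add: zero_le_mult_iff)
  qed
  then have "M *v x = l *\<^sub>R x" by (simp add: p_def)
  with xx that show thesis by blast
qed

text \<open>A homogeneous system with \<open>card I\<close> unknowns and \<open>card J\<close>
  equations has a nonzero solution. This one dimension count serves both to find a further
  eigenvector and to compare eigenvalues of two matrices.\<close>

lemma exists_kernel_vector_with_support:
  fixes f :: "'a::field ^ 'n::finite \<Rightarrow> 'a ^ 'm::finite"
  assumes f: "Vector_Spaces.linear (*s) (*s) f" and card: "card J < card I"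
  obtains y :: "'a ^ 'n" where "y \<noteq> 0" "\<And>i. i \<notin> I \<Longrightarrow> y $ i = 0" "\<And>j. j \<in> J \<Longrightarrow> f y $ j = 0"
proof -
  define X where "X = {y :: 'a ^ 'n. \<forall>i. i \<notin> I \<longrightarrow> y $ i = 0}"
  define Y where "Y = {y :: 'a ^ 'm. \<forall>i. i \<notin> J \<longrightarrow> y $ i = 0}"
  define g where "g y = (\<chi> j. if j \<in> J then f y $ j else 0)" for y
  interpret f: Vector_Spaces.linear "(*s)" "(*s)" f by (rule f)
  have g: "Vector_Spaces.linear (*s) (*s) g"
    by unfold_locales (auto simp: g_def vec_eq_iff f.add f.scale)
  have X: "vec.subspace X"
    by (auto simp: X_def vec.subspace_def)
  have dX: "vec.dim X = card I" unfolding X_def by (rule dim_substandard_cart)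
  have dY: "vec.dim Y = card J" unfolding Y_def by (rule dim_substandard_cart)
  have "\<not> inj_on g X"
  proof
    assume "inj_on g X"
    then have "vec.dim (g ` X) = vec.dim X"
      using vec.dim_image_eq[OF g, of X] X by (simp add: vec.span_eq_iff[THEN iffD2])
    moreover have "vec.dim (g ` X) \<le> vec.dim Y"
      by (rule vec.dim_subset) (auto simp: g_def Y_def)
    ultimately show False using dX dY card by simp
  qed
  then obtain a b where ab: "a \<in> X" "b \<in> X" "g a = g b" "a \<noteq> b"
    by (auto simp: inj_on_def)
  show thesis
  proof (rule that[of "a - b"])
    fix j assume "j \<in> J"
    then have "f a $ j = f b $ j"
      using arg_cong[OF ab(3), of "\<lambda>v. v $ j"] by (simp add: g_def)
    then show "f (a - b) $ j = 0" by (simp add: f.diff)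
  qed (use ab in \<open>auto simp: X_def\<close>)
qed

text \<open>Induction on the index set: the orthogonal complement \<open>W\<close> of the
  eigenvectors found so far is invariant under \<open>M\<close> because \<open>M\<close> is
  Hermitian, and it is nonzero because there are fewer conditions than coordinates.\<close>

lemma hermitian_orthonormal_eigenvectors:
  fixes M :: "('n::finite) cmatrix" and I :: "'n set"
  assumes M: "hermitian M"
  shows "\<exists>b l. (\<forall>i\<in>I. M *v b i = (l i :: real) *\<^sub>R b i) \<and>
    (\<forall>i\<in>I. \<forall>j\<in>I. cinner (b i) (b j) = (if i = j then 1 else 0))"
  using finite[of I]
proof induction
  case (insert k I)
  then obtain b l where eig: "\<And>i. i \<in> I \<Longrightarrow> M *v b i = (l i :: real) *\<^sub>R b i"
    and orth: "\<And>i j. i \<in> I \<Longrightarrow> j \<in> I \<Longrightarrow> cinner (b i) (b j) = (if i = j then 1 else 0)"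
    by blast
  define W where "W = {x. \<forall>i\<in>I. cinner x (b i) = 0}"
  have W: "subspace W"
    by (auto simp: W_def subspace_def cinner_add_left scaleR_eq_scale cinner_scale_left)
       (simp add: cinner_def)
  have inv: "M *v x \<in> W" if "x \<in> W" for x
    using that by (auto simp: W_def hermitian_cinner[OF M] eig scaleR_eq_scale cinner_scale_right)
  have "card I < card (UNIV :: 'n set)"
    using insert by (intro psubset_card_mono) auto
  moreover have "Vector_Spaces.linear (*s) (*s) (\<lambda>x. \<chi> i. cinner x (b i))"
    by unfold_locales (auto simp: vec_eq_iff cinner_add_left cinner_scale_left)
  ultimately obtain y where "y \<noteq> 0" "\<And>i. i \<in> I \<Longrightarrow> cinner y (b i) = 0"
    using exists_kernel_vector_with_support[of "\<lambda>x. \<chi> i. cinner x (b i)" I UNIV] by auto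
  then obtain x m where x: "x \<in> W" "norm x = 1" "M *v x = (m::real) *\<^sub>R x"
    using hermitian_eigenvector_in_subspace[OF M W inv, of y] by (auto simp: W_def)
  have "cinner x (b i) = 0" "cinner (b i) x = 0" if "i \<in> I" for i
    using x(1) that by (auto simp: W_def cinner_commute[of "b i" x])
  moreover have "cinner x x = 1"
    using x(2) by (simp add: cinner_self)
  ultimately show ?case
    using x eig orth insert.hyps
    by (intro exI[of _ "b(k := x)"] exI[of _ "l(k := m)"]) auto
qed auto

section \<open>Unitary diagonalization\<close>

definition diagonal_matrix :: "('n \<Rightarrow> real) \<Rightarrow> ('n::finite) cmatrix" where
  "diagonal_matrix l = (\<chi> i j. if i = j then of_real (l i) else 0)"

lemma diagonal_matrix_vector: "diagonal_matrix l *v x = (\<chi> i. of_real (l i) * x $ i)"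
  by (simp add: vec_eq_iff diagonal_matrix_def matrix_vector_mult_def if_distrib[of "\<lambda>a. a * _"]
      cong: if_cong)

text \<open>The columns of \<open>U\<close> form an orthonormal eigenbasis. The eigenvalues
  \<open>l\<close> are indexed like the matrix and are not ordered; multiplicity is the number of
  indices sharing a value.\<close>

definition diagonalizes :: "('n::finite) cmatrix \<Rightarrow> ('n \<Rightarrow> real) \<Rightarrow> 'n cmatrix \<Rightarrow> bool" where
  "diagonalizes U l M \<longleftrightarrow> adjoint_matrix U ** U = mat 1 \<and> M ** U = U ** diagonal_matrix l"

theorem hermitian_diagonalizable:
  fixes M :: "('n::finite) cmatrix"
  assumes M: "hermitian M"
  obtains U l where "diagonalizes U l M"
proof -
  obtain b :: "'n \<Rightarrow> complex ^ 'n" and l where eig: "\<And>i. M *v b i = (l i :: real) *\<^sub>R b i"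
    and orth: "\<And>i j. cinner (b i) (b j) = (if i = j then 1 else 0)"
    using hermitian_orthonormal_eigenvectors[OF M, of UNIV] by auto
  define U :: "'n cmatrix" where "U = (\<chi> r c. b c $ r)"
  have "adjoint_matrix U ** U = mat 1"
    using orth
    by (auto simp: vec_eq_iff adjoint_matrix_def U_def matrix_matrix_mult_def mat_def cinner_def mult.commute)
  moreover have "(M ** U) $ r $ c = (U ** diagonal_matrix l) $ r $ c" for r c
  proof -
    have "(M ** U) $ r $ c = (M *v b c) $ r"
      by (simp add: matrix_matrix_mult_def matrix_vector_mult_def U_def)
    also have "\<dots> = (U ** diagonal_matrix l) $ r $ c"
      by (simp add: eig matrix_matrix_mult_def U_def diagonal_matrix_def
          scaleR_conv_of_real[where 'a = complex] if_distrib[of "\<lambda>a. _ * a"] mult.commute cong: if_cong)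
    finally show ?thesis .
  qed
  ultimately show thesis
    using that[of U l] by (simp add: diagonalizes_def vec_eq_iff)
qed

lemma diagonalizes_right_inverse:
  "diagonalizes U l M \<Longrightarrow> U ** adjoint_matrix U = mat 1"
  by (simp add: diagonalizes_def matrix_left_right_inverse)

lemma diagonalizes_norm:
  fixes y :: "complex ^ 'n::finite"
  assumes "diagonalizes U l M"
  shows "(norm (U *v y))\<^sup>2 = (\<Sum>i\<in>UNIV. (cmod (y $ i))\<^sup>2)"
proof -
  have "(norm (U *v y))\<^sup>2 = (norm y)\<^sup>2"
    using assms
    by (simp add: power2_norm_eq_inner inner_matrix_vector matrix_vector_mul_assoc diagonalizes_def)
  then show ?thesis
    by (simp add: power2_norm_eq_inner inner_vec_def)
qed

lemma diagonalizes_quadratic_form: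
  fixes y :: "complex ^ 'n::finite"
  assumes "diagonalizes U l M"
  shows "(U *v y) \<bullet> (M *v (U *v y)) = (\<Sum>i\<in>UNIV. l i * (cmod (y $ i))\<^sup>2)"
proof -
  have "M *v (U *v y) = U *v (diagonal_matrix l *v y)"
    using assms by (simp add: matrix_vector_mul_assoc diagonalizes_def)
  then have "(U *v y) \<bullet> (M *v (U *v y)) = y \<bullet> (diagonal_matrix l *v y)"
    using assms
    by (simp add: inner_matrix_vector matrix_vector_mul_assoc[of "adjoint_matrix U" U] diagonalizes_def)
  also have "\<dots> = (\<Sum>i\<in>UNIV. l i * (cmod (y $ i))\<^sup>2)"
    unfolding inner_vec_def diagonal_matrix_vector cmod_power2
    by (simp add: inner_complex_def power2_eq_square algebra_simps)
  finally show ?thesis .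
qed

section \<open>Characteristic polynomial and eigenvalue counts\<close>

lemma poly_det:
  fixes P :: "'a::comm_ring_1 poly ^ 'n ^ 'n::finite"
  shows "poly (det P) z = det (\<chi> i j. poly (P $ i $ j) z)"
  by (simp add: det_def poly_sum poly_prod)

lemma poly_char_polynomial: "poly (char_polynomial M) z = det (mat z - M)"
  unfolding char_polynomial_def poly_det
  by (intro arg_cong[of _ _ det]) (simp add: vec_eq_iff mat_def)

text \<open>\<open>U\<close> conjugates \<open>mat z - M\<close> into a diagonal matrix for each
  number \<open>z\<close>; agreement of the two polynomials at every complex \<open>z\<close> then
  gives their equality.\<close>

lemma diagonalizes_char_polynomial:
  fixes M :: "('n::finite) cmatrix"
  assumes "diagonalizes U l M"
  shows "char_polynomial M = (\<Prod>i\<in>UNIV. [:- of_real (l i), 1:])"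
proof -
  have inv: "adjoint_matrix U ** U = mat 1" "U ** adjoint_matrix U = mat 1"
    using assms diagonalizes_right_inverse by (auto simp: diagonalizes_def)
  have "det (mat z - M) = (\<Prod>i\<in>UNIV. z - of_real (l i))" for z
  proof -
    have "(mat z - M) ** U = U ** (mat z - diagonal_matrix l)"
    proof -
      have "(A - B) ** C = A ** C - B ** C" "C ** (A - B) = C ** A - C ** B"
        for A B C :: "'n cmatrix"
        by (simp_all add: vec_eq_iff matrix_matrix_mult_def algebra_simps sum_subtractf)
      moreover have "mat z ** U = U ** mat z"
        by (simp add: vec_eq_iff matrix_matrix_mult_def mat_def if_distrib[of "\<lambda>a. _ * a"]
            if_distrib[of "\<lambda>a. a * _"] mult.commute cong: if_cong)
      ultimately show ?thesis
        using assms by (simp add: diagonalizes_def)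
    qed
    then have "det (mat z - M) * det U = det U * det (mat z - diagonal_matrix l)"
      by (metis det_mul)
    moreover have "det U \<noteq> 0"
      by (metis inv(1) det_I det_mul mult_zero_right zero_neq_one)
    moreover have "det (mat z - diagonal_matrix l) = (\<Prod>i\<in>UNIV. z - of_real (l i))"
      by (subst det_diagonal) (auto simp: mat_def diagonal_matrix_def)
    ultimately show ?thesis by simp
  qed
  then have "poly (char_polynomial M) = poly (\<Prod>i\<in>UNIV. [:- of_real (l i), 1:])"
    by (simp add: fun_eq_iff poly_char_polynomial poly_prod)
  then show ?thesis by (simp add: poly_eq_poly_eq_iff)
qed

lemma diagonalizes_eigenvalues:
  assumes "diagonalizes U l M"
  shows "mset (eigenvalues M) = image_mset l (mset_set UNIV)"
proof -
  have "proots (char_polynomial M) = (\<Sum>i\<in>UNIV. {#of_real (l i)#})"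
    unfolding diagonalizes_char_polynomial[OF assms] by (subst proots_prod) auto
  also have "\<dots> = image_mset (\<lambda>i. of_real (l i)) (mset_set UNIV)"
    by (simp add: sum_unfold_sum_mset)
  finally show ?thesis
    by (simp add: eigenvalues_def image_mset.compositionality o_def)
qed

text \<open>In a sorted list the positions of the entries below \<open>a\<close> form an initial
  segment. Counting \<open>j\<close> from 1 accounts for the index \<open>j - 1\<close>.\<close>

lemma sorted_nth_less_iff:
  fixes xs :: "'a::linorder list"
  assumes "sorted xs" "j \<in> {1..length xs}"
  shows "xs ! (j - 1) < a \<longleftrightarrow> j \<le> size (filter_mset (\<lambda>x. x < a) (mset xs))"
proof -
  let ?K = "{k. k < length xs \<and> xs ! k < a}"
  have size: "size (filter_mset (\<lambda>x. x < a) (mset xs)) = card ?K"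
    by (simp add: length_filter_conv_card flip: mset_filter)
  show ?thesis
  proof (cases "xs ! (j - 1) < a")
    case True
    have "k \<in> ?K" if "k < j" for k
      using le_less_trans[OF sorted_nth_mono[OF assms(1), of k "j - 1"] True] that assms(2) by auto
    then have "{..<j} \<subseteq> ?K" by blast
    then have "card {..<j} \<le> card ?K" by (intro card_mono) auto
    with True size show ?thesis by simp
  next
    case False
    have "k < j - 1" if "k \<in> ?K" for k
      using sorted_nth_mono[OF assms(1), of "j - 1" k] False that by fastforce
    then have "?K \<subseteq> {..<j - 1}" by blast
    then have "card ?K \<le> card {..<j - 1}" by (intro card_mono) auto
    with False size assms show ?thesis by auto
  qed
qed

text \<open>Turns bounds on ordered eigenvalues into cardinalities of index sets, so the diagonal
  entries \<open>l\<close> never have to be sorted.\<close>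

lemma nth_smallest_eigenvalue_less_iff:
  fixes M :: "('n::finite) cmatrix"
  assumes M: "diagonalizes U l M" and j: "j \<in> {1..CARD('n)}"
  shows "nth_smallest_eigenvalue j M < a \<longleftrightarrow> j \<le> card {i. l i < a}"
proof -
  have "length (eigenvalues M) = CARD('n)"
    using arg_cong[OF diagonalizes_eigenvalues[OF M], of size] by simp
  moreover have "sorted (eigenvalues M)"
    by (simp add: eigenvalues_def)
  ultimately show ?thesis
    using j sorted_nth_less_iff[of "eigenvalues M" j a]
    by (simp add: nth_smallest_eigenvalue_def diagonalizes_eigenvalues[OF M] filter_mset_image_mset)
qed

section \<open>Comparing eigenvalues through quadratic forms\<close>

text \<open>In eigenbasis coordinates \<open>y\<close> the form is a weighted sum of the
  \<open>l i\<close>, and only weights with \<open>l i < a\<close> are nonzero; a nonzero coordinate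
  makes the inequality strict.\<close>

lemma diagonalizes_quadratic_form_less:
  fixes y :: "complex ^ 'n::finite"
  assumes M: "diagonalizes U l M" and y: "y \<noteq> 0" "\<And>i. \<not> l i < a \<Longrightarrow> y $ i = 0"
  shows "(U *v y) \<bullet> (M *v (U *v y)) < a * (norm (U *v y))\<^sup>2"
proof -
  obtain k where k: "y $ k \<noteq> 0" using y(1) by (auto simp: vec_eq_iff)
  have "(\<Sum>i\<in>UNIV. l i * (cmod (y $ i))\<^sup>2) < (\<Sum>i\<in>UNIV. a * (cmod (y $ i))\<^sup>2)"
  proof (rule sum_strict_mono_ex1)
    show "\<forall>i\<in>UNIV. l i * (cmod (y $ i))\<^sup>2 \<le> a * (cmod (y $ i))\<^sup>2"
      using y(2) by (metis less_eq_real_def mult_right_mono norm_zero power2_eq_square mult_zero_right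
          zero_le_power2)
    show "\<exists>i\<in>UNIV. l i * (cmod (y $ i))\<^sup>2 < a * (cmod (y $ i))\<^sup>2"
      using k y(2)[of k] by (intro bexI[of _ k]) auto
  qed simp
  then show ?thesis
    by (simp add: diagonalizes_norm[OF M] diagonalizes_quadratic_form[OF M] sum_distrib_left)
qed

lemma diagonalizes_quadratic_form_ge:
  fixes y :: "complex ^ 'n::finite"
  assumes M: "diagonalizes U l M" and y: "\<And>i. l i < a \<Longrightarrow> y $ i = 0"
  shows "a * (norm (U *v y))\<^sup>2 \<le> (U *v y) \<bullet> (M *v (U *v y))"
  unfolding diagonalizes_norm[OF M] diagonalizes_quadratic_form[OF M] sum_distrib_left
proof (rule sum_mono)
  fix i
  show "a * (cmod (y $ i))\<^sup>2 \<le> l i * (cmod (y $ i))\<^sup>2"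
    using y[of i] by (cases "l i < a") (auto intro: mult_right_mono)
qed

text \<open>
  The subspace on which \<open>M\<close> is below \<open>a\<close> is mapped by \<open>f\<close> into vectors on which \<open>N\<close> is below \<open>b\<close>,
  so its image avoids the eigenspaces of \<open>N\<close> above \<open>b\<close>; comparing dimensions bounds the counts.
\<close>

lemma nth_smallest_eigenvalue_compare:
  fixes M :: "('m::finite) cmatrix" and N :: "('n::finite) cmatrix"
    and f :: "complex ^ 'm \<Rightarrow> complex ^ 'n"
  assumes M: "hermitian M" and N: "hermitian N" and f: "Vector_Spaces.linear (*s) (*s) f"
    and less: "\<And>x. x \<bullet> (M *v x) < a * (norm x)\<^sup>2 \<Longrightarrow> f x \<bullet> (N *v f x) < b * (norm (f x))\<^sup>2"
    and j: "j \<in> {1..CARD('m)}" "j \<le> CARD('n)" and ja: "nth_smallest_eigenvalue j M < a"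
  shows "nth_smallest_eigenvalue j N < b"
proof -
  obtain U l where U: "diagonalizes U l M" using hermitian_diagonalizable[OF M] .
  obtain V m where V: "diagonalizes V m N" using hermitian_diagonalizable[OF N] .
  have "card {i. l i < a} \<le> card {i. m i < b}"
  proof (rule ccontr)
    assume "\<not> ?thesis"
    moreover have "Vector_Spaces.linear (*s) (*s) (\<lambda>y. adjoint_matrix V *v f (U *v y))"
      using Vector_Spaces.linear_compose[OF Vector_Spaces.linear_compose[OF matrix_vector_mul_linear_gen[of U] f]
          matrix_vector_mul_linear_gen[of "adjoint_matrix V"]]
      by (simp add: o_def)
    \<comment> \<open>If \<open>M\<close> had more eigenvalues below \<open>a\<close> than
      \<open>N\<close> has below \<open>b\<close>, some nonzero combination of the low eigenvectors
      of \<open>M\<close> would be sent by \<open>f\<close> to a vector orthogonal to all low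
      eigenvectors of \<open>N\<close>.\<close>
    ultimately obtain y :: "complex ^ 'm" where y: "y \<noteq> 0" "\<And>i. i \<notin> {i. l i < a} \<Longrightarrow> y $ i = 0"
      "\<And>i. i \<in> {i. m i < b} \<Longrightarrow> (adjoint_matrix V *v f (U *v y)) $ i = 0"
      by (metis exists_kernel_vector_with_support not_le)
    define z where "z = adjoint_matrix V *v f (U *v y)"
    have z: "V *v z = f (U *v y)"
      by (simp add: z_def matrix_vector_mul_assoc diagonalizes_right_inverse[OF V])
    have "(V *v z) \<bullet> (N *v (V *v z)) < b * (norm (V *v z))\<^sup>2"
      unfolding z using y by (intro less diagonalizes_quadratic_form_less[OF U]) auto
    moreover have "b * (norm (V *v z))\<^sup>2 \<le> (V *v z) \<bullet> (N *v (V *v z))"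
      using y(3) by (intro diagonalizes_quadratic_form_ge[OF V]) (auto simp: z_def)
    ultimately show False by simp
  qed
  with ja j show ?thesis
    by (simp add: nth_smallest_eigenvalue_less_iff[OF U] nth_smallest_eigenvalue_less_iff[OF V])
qed

text \<open>Each \<open>l i\<close> is the value of the form at the unit eigenvector
  \<open>U *v axis i 1\<close>, so all of them lie below \<open>b\<close>.\<close>

lemma nth_smallest_eigenvalue_less:
  fixes M :: "('n::finite) cmatrix"
  assumes M: "hermitian M" and less: "\<And>x. x \<noteq> 0 \<Longrightarrow> x \<bullet> (M *v x) < b * (norm x)\<^sup>2"
    and j: "j \<in> {1..CARD('n)}"
  shows "nth_smallest_eigenvalue j M < b"
proof -
  obtain U l where U: "diagonalizes U l M" using hermitian_diagonalizable[OF M] .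
  have "l i < b" for i
  proof (rule ccontr)
    assume i: "\<not> l i < b"
    have y: "(norm (U *v axis i 1))\<^sup>2 = 1"
      by (simp add: diagonalizes_norm[OF U] axis_def if_distrib[of "\<lambda>z. (cmod z)\<^sup>2"] cong: if_cong)
    then have "U *v axis i 1 \<noteq> 0" by auto
    from less[OF this] have "\<not> b * (norm (U *v axis i 1))\<^sup>2 \<le> (U *v axis i 1) \<bullet> (M *v (U *v axis i 1))"
      by simp
    moreover have "axis i (1 :: complex) $ k = 0" if "l k < b" for k
      using i that by (auto simp: axis_def)
    ultimately show False
      using diagonalizes_quadratic_form_ge[OF U, of b "axis i 1"] by blast
  qed
  with j show ?thesis by (simp add: nth_smallest_eigenvalue_less_iff[OF U])
qed

section \<open>The gadget\<close>

lemma extend_mult_disjoint: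
  assumes "S \<inter> T = {}"
  shows "extend S A ** extend T B = extend (S \<union> T) (local_tensor S T A B)"
proof -
  have "(\<Sum>z\<in>UNIV. extend S A $ x $ z * extend T B $ z $ y)
      = extend (S \<union> T) (local_tensor S T A B) $ x $ y" for x y
  proof -
    \<comment> \<open>The only intermediate basis state that contributes to the matrix product:
      \<open>A\<close> leaves the qubits outside \<open>S\<close> as in \<open>x\<close>, and
      \<open>B\<close> leaves those outside \<open>T\<close>, in particular those in
      \<open>S\<close>, as in \<open>y\<close>.\<close>
    let ?w = "(y \<inter> S) \<union> (x - S)"
    have "z = ?w" if "x - S = z - S" "z - T = y - T" for z
      using that assms by blast
    then have "extend S A $ x $ z * extend T B $ z $ y = 0" if "z \<noteq> ?w" for z
      using that by (auto simp: extend_def)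
    then have "(\<Sum>z\<in>UNIV. extend S A $ x $ z * extend T B $ z $ y)
        = (\<Sum>z\<in>{?w}. extend S A $ x $ z * extend T B $ z $ y)"
      by (intro sum.mono_neutral_right) auto
    also have "\<dots> = extend (S \<union> T) (local_tensor S T A B) $ x $ y"
    proof -
      have "x - S = ?w - S" "?w \<inter> S = y \<inter> S" "?w \<inter> T = x \<inter> T"
        "(x \<inter> (S \<union> T)) \<inter> S = x \<inter> S" "(y \<inter> (S \<union> T)) \<inter> S = y \<inter> S"
        "(x \<inter> (S \<union> T)) \<inter> T = x \<inter> T" "(y \<inter> (S \<union> T)) \<inter> T = y \<inter> T"
        using assms by blast+
      moreover have "?w - T = y - T \<longleftrightarrow> x - (S \<union> T) = y - (S \<union> T)"
        using assms by blast
      ultimately show ?thesis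
        by (simp add: extend_def local_tensor_def)
    qed
    finally show ?thesis .
  qed
  then show ?thesis by (simp add: vec_eq_iff matrix_matrix_mult_def)
qed

lemma local_tensor_commute: "local_tensor S T A B = local_tensor T S B A"
  by (simp add: local_tensor_def mult.commute)

lemma adjoint_matrix_simps:
  "adjoint_matrix (M + N) = adjoint_matrix M + adjoint_matrix N"
  "adjoint_matrix (M - N) = adjoint_matrix M - adjoint_matrix N"
  "adjoint_matrix (r *\<^sub>R M) = r *\<^sub>R adjoint_matrix M"
  "adjoint_matrix (M ** N) = adjoint_matrix N ** adjoint_matrix M"
  "adjoint_matrix (mat 1) = mat 1"
  by (simp_all add: vec_eq_iff adjoint_matrix_def matrix_matrix_mult_def mat_def mult.commute)

lemma adjoint_matrix_slack_simps:
  "adjoint_matrix (M \<otimes>\<^sub>w P) = adjoint_matrix M \<otimes>\<^sub>w adjoint_matrix P"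
  "adjoint_matrix proj0 = proj0" "adjoint_matrix proj1 = proj1" "adjoint_matrix pauli_X = pauli_X"
  by (auto simp: vec_eq_iff adjoint_matrix_def tensor_slack_def proj0_def proj1_def pauli_X_def)

section \<open>Splitting off the slack qubit\<close>

definition slack_component :: "bool \<Rightarrow> complex ^ ('i \<times> bool) \<Rightarrow> complex ^ 'i::finite" where
  "slack_component b x = (\<chi> i. x $ (i, b))"

definition slack_join :: "complex ^ 'i \<Rightarrow> complex ^ 'i \<Rightarrow> complex ^ ('i::finite \<times> bool)" where
  "slack_join v u = (\<chi> p. if snd p then u $ fst p else v $ fst p)"

lemma slack_component_join [simp]:
  "slack_component False (slack_join v u) = v" "slack_component True (slack_join v u) = u"
  by (simp_all add: slack_component_def slack_join_def vec_eq_iff)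

lemma sum_slack:
  "(\<Sum>p\<in>UNIV. g p) = (\<Sum>i\<in>UNIV. g (i, False)) + (\<Sum>i\<in>UNIV. g (i, True))"
  for g :: "'i::finite \<times> bool \<Rightarrow> 'a::comm_monoid_add"
proof -
  have "(\<Sum>p\<in>UNIV. g p) = (\<Sum>i\<in>UNIV. \<Sum>b\<in>UNIV. g (i, b))"
    unfolding UNIV_Times_UNIV[symmetric] sum.cartesian_product by (simp add: case_prod_beta)
  then show ?thesis by (simp add: UNIV_bool sum.distrib)
qed

lemma inner_slack:
  "x \<bullet> y = slack_component False x \<bullet> slack_component False y
    + slack_component True x \<bullet> slack_component True y"
  by (simp add: inner_vec_def sum_slack slack_component_def)

lemma norm_slack:
  "(norm x)\<^sup>2 = (norm (slack_component False x))\<^sup>2 + (norm (slack_component True x))\<^sup>2"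
  by (simp add: power2_norm_eq_inner inner_slack[of x x])

lemma slack_component_add: "slack_component b (x + y) = slack_component b x + slack_component b y"
  by (simp add: slack_component_def vec_eq_iff)

lemma slack_component_scaleR: "slack_component b (r *\<^sub>R x) = r *\<^sub>R slack_component b x"
  by (simp add: slack_component_def vec_eq_iff)

lemma slack_component_tensor:
  "slack_component b ((M \<otimes>\<^sub>w P) *v x) =
    P $ b $ False *s (M *v slack_component False x) + P $ b $ True *s (M *v slack_component True x)"
  by (simp add: slack_component_def vec_eq_iff matrix_vector_mult_def tensor_slack_def sum_slack
      sum_distrib_left algebra_simps)

text \<open>
  Splitting \<open>(p + q)\<^sup>2\<close> with the weight \<open>k\<close> balances the two summands against \<open>\<Delta> \<ge> (k + 1) G\<close>;
  this is what makes the bound on \<open>\<Delta>\<close> sufficient.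
\<close>

lemma weighted_square_bound:
  fixes G \<Delta> \<epsilon> k p q N :: real
  assumes "0 \<le> G" "0 < \<Delta>" "0 \<le> k" "(k + 1) * G \<le> \<Delta>" "\<Delta> * q\<^sup>2 \<le> k * (\<epsilon> * N)" "0 \<le> \<epsilon> * N"
  shows "G * (p + q)\<^sup>2 \<le> \<Delta> * p\<^sup>2 + \<epsilon> * N"
proof (cases "k = 0")
  case True
  then have "q = 0"
    using assms by (simp add: mult_le_0_iff)
  moreover have "G * p\<^sup>2 \<le> \<Delta> * p\<^sup>2"
    using True assms by (intro mult_right_mono) auto
  ultimately show ?thesis using assms by simp
next
  case False
  then have k: "0 < k" using assms by simp
  have "k * (p + q)\<^sup>2 \<le> (k + 1) * (k * p\<^sup>2 + q\<^sup>2)"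
    using zero_le_power2[of "k * p - q"] by (simp add: power2_eq_square algebra_simps)
  then have "G * (k * (p + q)\<^sup>2) \<le> G * ((k + 1) * (k * p\<^sup>2 + q\<^sup>2))"
    using assms by (intro mult_left_mono)
  also have "\<dots> = ((k + 1) * G) * (k * p\<^sup>2 + q\<^sup>2)"
    by simp
  also have "\<dots> \<le> \<Delta> * (k * p\<^sup>2 + q\<^sup>2)"
    using assms by (intro mult_right_mono) auto
  also have "\<dots> \<le> k * (\<Delta> * p\<^sup>2 + \<epsilon> * N)"
    using assms by (simp add: algebra_simps)
  finally have "k * (G * (p + q)\<^sup>2) \<le> k * (\<Delta> * p\<^sup>2 + \<epsilon> * N)"
    by (simp add: algebra_simps)
  then show ?thesis using k by simp
qed

section \<open>Quadratic forms of target and gadget\<close>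

locale subdivision_gadget =
  fixes H_else :: "'q::finite set cmatrix"
    and S T :: "'q set"
    and A B :: "'q local_op"
    and \<alpha> \<Delta> :: real
  assumes herm_else: "hermitian H_else"
    and disjoint: "S \<inter> T = {}"
    and herm_A: "hermitian (extend S A)"
    and herm_B: "hermitian (extend T B)"
    and norm_A: "op_norm (extend S A) = 1"
    and norm_B: "op_norm (extend T B) = 1"
    and Delta_pos: "\<Delta> > 0"
begin

text \<open>The off-diagonal block of the gadget, which links the sectors with slack state 0 and
  1.\<close>

definition coupling :: "'q set cmatrix" where
  "coupling = sqrt (\<bar>\<alpha>\<bar> * \<Delta> / 2) *\<^sub>R (sgn \<alpha> *\<^sub>R extend S A - extend T B)"

abbreviation target :: "'q set cmatrix" where
  "target \<equiv> H_target H_else \<alpha> S T A B"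

abbreviation gadget :: "('q set \<times> bool) cmatrix" where
  "gadget \<equiv> H_gadget H_else \<alpha> \<Delta> S T A B"

text \<open>The product of the two local operators is Hermitian because operators on disjoint sets
  of qubits commute.\<close>

lemma hermitian_target: "hermitian target"
proof -
  have AB: "extend (S \<union> T) (local_tensor S T A B) = extend S A ** extend T B"
    using extend_mult_disjoint[OF disjoint] by simp
  also have "\<dots> = extend T B ** extend S A"
    using extend_mult_disjoint[OF disjoint, of A B] extend_mult_disjoint[of T S B A] disjoint
    by (simp add: Int_commute[of T S] Un_commute[of T S] local_tensor_commute[of T S])
  finally have "adjoint_matrix (extend (S \<union> T) (local_tensor S T A B)) =
      extend (S \<union> T) (local_tensor S T A B)"
    using herm_A herm_B unfolding AB by (simp add: adjoint_matrix_simps hermitian_iff_adjoint)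
  then show ?thesis
    using herm_else by (simp add: hermitian_iff_adjoint H_target_def adjoint_matrix_simps)
qed

lemma hermitian_gadget: "hermitian gadget"
  using herm_else herm_A herm_B
  by (simp add: hermitian_iff_adjoint H_gadget_def gadget_V_def adjoint_matrix_simps
      adjoint_matrix_slack_simps)

lemma norm_A_vector: "norm (extend S A *v v) \<le> norm v"
  using norm_matrix_vector_le[of "extend S A" v] norm_A by simp

lemma norm_B_vector: "norm (extend T B *v v) \<le> norm v"
  using norm_matrix_vector_le[of "extend T B" v] norm_B by simp

lemma target_quadratic_form:
  "v \<bullet> (target *v v) = v \<bullet> (H_else *v v) + \<alpha> * ((extend S A *v v) \<bullet> (extend T B *v v))"
  by (simp add: H_target_def matrix_vector_mult_add_rdistrib scaleR_matrix_vector inner_add_right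
      hermitian_inner[OF herm_A] matrix_vector_mul_assoc extend_mult_disjoint[OF disjoint])

lemma abs_target_quadratic_form_le:
  "\<bar>v \<bullet> (target *v v)\<bar> \<le> (op_norm H_else + \<bar>\<alpha>\<bar>) * (norm v)\<^sup>2"
proof -
  have "\<bar>(extend S A *v v) \<bullet> (extend T B *v v)\<bar> \<le> norm (extend S A *v v) * norm (extend T B *v v)"
    by (rule Cauchy_Schwarz_ineq2)
  also have "\<dots> \<le> (norm v)\<^sup>2"
    unfolding power2_eq_square by (intro mult_mono norm_A_vector norm_B_vector) auto
  finally have "\<bar>\<alpha> * ((extend S A *v v) \<bullet> (extend T B *v v))\<bar> \<le> \<bar>\<alpha>\<bar> * (norm v)\<^sup>2"
    unfolding abs_mult by (intro mult_left_mono) auto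
  then show ?thesis
    unfolding target_quadratic_form using abs_quadratic_form_le[of v H_else]
    by (simp add: algebra_simps)
qed

text \<open>By the triangle inequality \<open>sgn \<alpha> A - B\<close> has norm at most 2; its
  square 4 times the prefactor \<open>|\<alpha>| \<Delta> / 2\<close> gives the constant.\<close>

lemma norm_coupling: "(norm (coupling *v v))\<^sup>2 \<le> 2 * \<bar>\<alpha>\<bar> * \<Delta> * (norm v)\<^sup>2"
proof -
  let ?D = "sgn \<alpha> *\<^sub>R (extend S A *v v) - extend T B *v v"
  have "norm ?D \<le> norm (sgn \<alpha> *\<^sub>R (extend S A *v v)) + norm (extend T B *v v)"
    by (rule norm_triangle_ineq4)
  also have "norm (sgn \<alpha> *\<^sub>R (extend S A *v v)) \<le> norm (extend S A *v v)"
    by (simp add: sgn_if)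
  finally have "norm ?D \<le> 2 * norm v"
    using norm_A_vector[of v] norm_B_vector[of v] by simp
  then have "(norm ?D)\<^sup>2 \<le> (2 * norm v)\<^sup>2"
    by (intro power_mono) auto
  then have "\<bar>\<alpha>\<bar> * \<Delta> / 2 * (norm ?D)\<^sup>2 \<le> \<bar>\<alpha>\<bar> * \<Delta> / 2 * (2 * norm v)\<^sup>2"
    using Delta_pos by (intro mult_left_mono) auto
  moreover have "(norm (coupling *v v))\<^sup>2 = \<bar>\<alpha>\<bar> * \<Delta> / 2 * (norm ?D)\<^sup>2"
    using Delta_pos
    by (simp add: coupling_def scaleR_matrix_vector matrix_vector_mult_diff_rdistrib power_mult_distrib)
  ultimately show ?thesis by (simp add: power_mult_distrib algebra_simps)
qed

text \<open>
  Completing the square in the slack amplitude: the term \<open>- 2 sgn \<alpha> A B\<close> of \<open>(sgn \<alpha> A - B)\<^sup>2\<close>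
  produces the interaction of the target, and \<open>A\<^sup>2 + B\<^sup>2\<close> is cancelled by the term of \<open>V\<close> on
  \<open>|0\<rangle>\<langle>0|\<close>.
\<close>

lemma gadget_quadratic_form:
  fixes x :: "complex ^ ('q set \<times> bool)"
  defines "v \<equiv> slack_component False x" and "u \<equiv> slack_component True x"
  shows "x \<bullet> (gadget *v x) = v \<bullet> (target *v v) + u \<bullet> (H_else *v u)
    + \<Delta> * (norm (u + (1 / \<Delta>) *\<^sub>R (coupling *v v)))\<^sup>2"
proof -
  let ?A = "extend S A" and ?B = "extend T B"
  have V: "gadget *v x = \<Delta> *\<^sub>R ((mat 1 \<otimes>\<^sub>w proj1) *v x) + ((H_else \<otimes>\<^sub>w mat 1) *v x
      + (\<bar>\<alpha>\<bar> / 2) *\<^sub>R (((?A ** ?A + ?B ** ?B) \<otimes>\<^sub>w proj0) *v x)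
      + sqrt (\<bar>\<alpha>\<bar> * \<Delta> / 2) *\<^sub>R (((sgn \<alpha> *\<^sub>R ?A - ?B) \<otimes>\<^sub>w pauli_X) *v x))"
    by (simp only: H_gadget_def gadget_V_def matrix_vector_mult_add_rdistrib scaleR_matrix_vector)
  have low: "slack_component False (gadget *v x) =
      H_else *v v + (\<bar>\<alpha>\<bar> / 2) *\<^sub>R (?A *v (?A *v v) + ?B *v (?B *v v)) + coupling *v u"
    unfolding V slack_component_add slack_component_scaleR slack_component_tensor
    by (simp add: proj0_def proj1_def pauli_X_def mat_def[of 1] v_def u_def coupling_def
        scaleR_matrix_vector matrix_vector_mult_add_rdistrib matrix_vector_mul_assoc)
  have high: "slack_component True (gadget *v x) = \<Delta> *\<^sub>R u + H_else *v u + coupling *v v"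
    unfolding V slack_component_add slack_component_scaleR slack_component_tensor
    by (simp add: proj0_def proj1_def pauli_X_def v_def u_def coupling_def
        scaleR_matrix_vector)
      (simp add: mat_def)
  have herm_C: "hermitian coupling"
    using herm_A herm_B by (simp add: hermitian_iff_adjoint coupling_def adjoint_matrix_simps)
  have sq: "(norm (coupling *v v))\<^sup>2 =
      \<Delta> * (\<bar>\<alpha>\<bar> / 2 * ((norm (?A *v v))\<^sup>2 + (norm (?B *v v))\<^sup>2) - \<alpha> * ((?A *v v) \<bullet> (?B *v v)))"
  proof -
    have "(norm (coupling *v v))\<^sup>2 = \<bar>\<alpha>\<bar> * \<Delta> / 2 * (norm (sgn \<alpha> *\<^sub>R (?A *v v) - ?B *v v))\<^sup>2"
      using Delta_pos
      by (simp add: coupling_def scaleR_matrix_vector matrix_vector_mult_diff_rdistrib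
          power_mult_distrib)
    also have "\<dots> = \<bar>\<alpha>\<bar> * \<Delta> / 2 *
        ((sgn \<alpha>)\<^sup>2 * (norm (?A *v v))\<^sup>2 + (norm (?B *v v))\<^sup>2 - 2 * sgn \<alpha> * ((?A *v v) \<bullet> (?B *v v)))"
      unfolding power2_norm_eq_inner
      by (simp add: inner_diff_left inner_diff_right inner_commute power2_eq_square algebra_simps)
    \<comment> \<open>For nonzero \<open>\<alpha>\<close> the square of \<open>sgn \<alpha>\<close>
      is 1 and \<open>|\<alpha>| sgn \<alpha> = \<alpha>\<close>; for \<open>\<alpha> = 0\<close>
      both sides vanish.\<close>
    also have "\<dots> = \<Delta> * (\<bar>\<alpha>\<bar> / 2 * ((norm (?A *v v))\<^sup>2 + (norm (?B *v v))\<^sup>2)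
        - \<alpha> * ((?A *v v) \<bullet> (?B *v v)))"
      by (cases "\<alpha> = 0") (auto simp: sgn_if algebra_simps)
    finally show ?thesis .
  qed
  \<comment> \<open>The two off-diagonal blocks contribute equally because the coupling is
    Hermitian, whence the factor 2 in the cross term.\<close>
  have "x \<bullet> (gadget *v x) = v \<bullet> (H_else *v v)
      + \<bar>\<alpha>\<bar> / 2 * ((norm (?A *v v))\<^sup>2 + (norm (?B *v v))\<^sup>2)
      + \<Delta> * (norm u)\<^sup>2 + u \<bullet> (H_else *v u) + 2 * (u \<bullet> (coupling *v v))"
    unfolding inner_slack[of x "gadget *v x"] low high v_def[symmetric] u_def[symmetric]
    using hermitian_inner[OF herm_C, of v u] hermitian_inner[OF herm_A, of v "?A *v v"]
      hermitian_inner[OF herm_B, of v "?B *v v"]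
    by (simp add: inner_add_right power2_norm_eq_inner inner_commute[of u "coupling *v v"]
        algebra_simps)
  moreover have "\<Delta> * (norm (u + (1 / \<Delta>) *\<^sub>R (coupling *v v)))\<^sup>2 =
      \<Delta> * (norm u)\<^sup>2 + 2 * (u \<bullet> (coupling *v v)) + (norm (coupling *v v))\<^sup>2 / \<Delta>"
    using Delta_pos unfolding power2_norm_eq_inner
    by (simp add: inner_add_left inner_add_right inner_commute[of "coupling *v v" u] field_simps)
  moreover have "(norm (coupling *v v))\<^sup>2 / \<Delta> =
      \<bar>\<alpha>\<bar> / 2 * ((norm (?A *v v))\<^sup>2 + (norm (?B *v v))\<^sup>2) - \<alpha> * ((?A *v v) \<bullet> (?B *v v))"
    unfolding sq using Delta_pos by simp
  ultimately show ?thesis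
    unfolding target_quadratic_form by (simp add: algebra_simps)
qed

section \<open>Eigenvalue bounds for large \<open>\<Delta>\<close>\<close>

context
  fixes \<epsilon> G :: real
  assumes eps_pos: "\<epsilon> > 0" and G_def: "G = 2 * op_norm H_else + \<bar>\<alpha>\<bar>"
    and Delta_large: "\<Delta> \<ge> (2 * \<bar>\<alpha>\<bar> / \<epsilon> + 1) * (G + \<epsilon>)"
begin

text \<open>The weight \<open>k = 2 |\<alpha>| / \<epsilon>\<close> turns the coupling bound
  \<open>2 |\<alpha>| (norm v)\<^sup>2\<close> into \<open>k\<close> times the allowed error
  \<open>\<epsilon> (norm v)\<^sup>2\<close>. The upper eigenvalue bound takes \<open>p = 0\<close>,
  the lower one takes \<open>p\<close> to be the norm of the completed square.\<close>

lemma slack_amplitude_bound: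
  "G * (p + norm ((1 / \<Delta>) *\<^sub>R (coupling *v v)))\<^sup>2 \<le> \<Delta> * p\<^sup>2 + \<epsilon> * (norm v)\<^sup>2"
proof (rule weighted_square_bound[where k = "2 * \<bar>\<alpha>\<bar> / \<epsilon>"])
  have "(2 * \<bar>\<alpha>\<bar> / \<epsilon> + 1) * G \<le> (2 * \<bar>\<alpha>\<bar> / \<epsilon> + 1) * (G + \<epsilon>)"
    using eps_pos by (intro mult_left_mono) auto
  with Delta_large show "(2 * \<bar>\<alpha>\<bar> / \<epsilon> + 1) * G \<le> \<Delta>" by linarith
  have "\<Delta> * (norm ((1 / \<Delta>) *\<^sub>R (coupling *v v)))\<^sup>2 = (norm (coupling *v v))\<^sup>2 / \<Delta>"
    using Delta_pos by (simp add: power2_eq_square)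
  also have "\<dots> \<le> 2 * \<bar>\<alpha>\<bar> * (norm v)\<^sup>2"
    using norm_coupling[of v] Delta_pos by (simp add: field_simps)
  finally show "\<Delta> * (norm ((1 / \<Delta>) *\<^sub>R (coupling *v v)))\<^sup>2 \<le> 2 * \<bar>\<alpha>\<bar> / \<epsilon> * (\<epsilon> * (norm v)\<^sup>2)"
    using eps_pos by simp
qed (use eps_pos Delta_pos op_norm_nonneg[of H_else] in \<open>auto simp: G_def\<close>)

lemma gadget_eigenvalue_upper:
  assumes j: "j \<in> {1..CARD('q set)}" and c: "nth_smallest_eigenvalue j target < c"
  shows "nth_smallest_eigenvalue j gadget < c + \<epsilon>"
proof (rule nth_smallest_eigenvalue_compare[OF hermitian_target hermitian_gadget _ _ j _ c])
  let ?w = "\<lambda>v. (1 / \<Delta>) *\<^sub>R (coupling *v v)"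
  \<comment> \<open>With this slack amplitude the completed square vanishes, so the only excess over
    the target energy is the \<open>H_else\<close> energy of \<open>?w v\<close>.\<close>
  let ?f = "\<lambda>v. slack_join v (- ?w v)"
  show "Vector_Spaces.linear (*s) (*s) ?f"
    by unfold_locales (auto simp: vec_eq_iff slack_join_def matrix_vector_right_distrib
        vector_scalar_commute algebra_simps)
  fix v assume v: "v \<bullet> (target *v v) < c * (norm v)\<^sup>2"
  then have "v \<noteq> 0" by auto
  \<comment> \<open>A vector with target energy below \<open>c\<close> forces \<open>c\<close> above
    the lower bound of the target form; hence \<open>G\<close> dominates the cost
    \<open>op_norm H_else - c\<close> per unit of slack weight.\<close>
  have "- (op_norm H_else + \<bar>\<alpha>\<bar>) * (norm v)\<^sup>2 < c * (norm v)\<^sup>2"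
    using abs_target_quadratic_form_le[of v] v by (simp add: abs_le_iff algebra_simps)
  then have "op_norm H_else - c \<le> G"
    using \<open>v \<noteq> 0\<close> by (simp add: G_def)
  then have "(op_norm H_else - c) * (norm (?w v))\<^sup>2 \<le> G * (norm (?w v))\<^sup>2"
    by (intro mult_right_mono) auto
  also have "\<dots> \<le> \<epsilon> * (norm v)\<^sup>2"
    using slack_amplitude_bound[of 0 v] by simp
  finally have "op_norm H_else * (norm (?w v))\<^sup>2 \<le> \<epsilon> * (norm v)\<^sup>2 + c * (norm (?w v))\<^sup>2"
    by (simp add: algebra_simps)
  moreover have "- ?w v \<bullet> (H_else *v (- ?w v)) \<le> op_norm H_else * (norm (?w v))\<^sup>2"
    using abs_quadratic_form_le[of "- ?w v" H_else] by (simp only: abs_le_iff norm_minus_cancel)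
  moreover have "0 \<le> \<epsilon> * (norm (?w v))\<^sup>2"
    using eps_pos by simp
  ultimately show "?f v \<bullet> (gadget *v ?f v) < (c + \<epsilon>) * (norm (?f v))\<^sup>2"
    using v unfolding gadget_quadratic_form norm_slack slack_component_join
    by (simp add: algebra_simps)
next
  show "j \<le> CARD('q set \<times> bool)" using j by simp
qed

lemma gadget_eigenvalue_lower:
  assumes j: "j \<in> {1..CARD('q set)}"
  shows "nth_smallest_eigenvalue j target - \<epsilon> \<le> nth_smallest_eigenvalue j gadget"
proof (rule ccontr)
  define c where "c = nth_smallest_eigenvalue j target"
  \<comment> \<open>The target form bounds its eigenvalues from above; this makes \<open>G\<close>
    dominate \<open>op_norm H_else + c\<close>, the most that a unit of slack weight can lower the
    energy relative to \<open>c\<close>.\<close>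
  have "c \<le> op_norm H_else + \<bar>\<alpha>\<bar>"
  proof (rule dense_ge)
    fix b assume "op_norm H_else + \<bar>\<alpha>\<bar> < b"
    then have "v \<bullet> (target *v v) < b * (norm v)\<^sup>2" if "v \<noteq> 0" for v
      using abs_target_quadratic_form_le[of v] that
      by (intro le_less_trans[of "v \<bullet> (target *v v)" "(op_norm H_else + \<bar>\<alpha>\<bar>) * (norm v)\<^sup>2"]) auto
    then show "c \<le> b"
      unfolding c_def using nth_smallest_eigenvalue_less[OF hermitian_target _ j, of b] by fastforce
  qed
  then have cG: "op_norm H_else + c \<le> G" by (simp add: G_def)
  assume "\<not> ?thesis"
  then have less: "nth_smallest_eigenvalue j gadget < c - \<epsilon>" by (simp add: c_def)
  have "nth_smallest_eigenvalue j target < c"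
  proof (rule nth_smallest_eigenvalue_compare[OF hermitian_gadget hermitian_target _ _ _ _ less,
        where f = "slack_component False"])
    show "Vector_Spaces.linear (*s) (*s) (slack_component False :: _ \<Rightarrow> complex ^ 'q set)"
      by unfold_locales (auto simp: vec_eq_iff slack_component_def)
    fix x :: "complex ^ ('q set \<times> bool)"
    assume x: "x \<bullet> (gadget *v x) < (c - \<epsilon>) * (norm x)\<^sup>2"
    define v where "v = slack_component False x"
    define u where "u = slack_component True x"
    define w where "w = (1 / \<Delta>) *\<^sub>R (coupling *v v)"
    \<comment> \<open>A large slack amplitude \<open>u\<close> means a large square
      \<open>u + w\<close>, up to the shift \<open>w\<close> controlled by \<open>v\<close>; the
      penalty \<open>\<Delta>\<close> on the square then pays for the slack sector.\<close>
    have "norm u \<le> norm (u + w) + norm w"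
      using norm_triangle_ineq4[of "u + w" w] by simp
    then have "(norm u)\<^sup>2 \<le> (norm (u + w) + norm w)\<^sup>2"
      by (intro power_mono) auto
    then have "G * (norm u)\<^sup>2 \<le> G * (norm (u + w) + norm w)\<^sup>2"
      using op_norm_nonneg[of H_else] by (intro mult_left_mono) (auto simp: G_def)
    also have "\<dots> \<le> \<Delta> * (norm (u + w))\<^sup>2 + \<epsilon> * (norm v)\<^sup>2"
      unfolding w_def by (rule slack_amplitude_bound)
    finally have "G * (norm u)\<^sup>2 \<le> \<Delta> * (norm (u + w))\<^sup>2 + \<epsilon> * (norm v)\<^sup>2" .
    moreover have "(op_norm H_else + c) * (norm u)\<^sup>2 \<le> G * (norm u)\<^sup>2"
      using cG by (intro mult_right_mono) auto
    moreover have "- (op_norm H_else * (norm u)\<^sup>2) \<le> u \<bullet> (H_else *v u)"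
      using abs_quadratic_form_le[of u H_else] by (simp add: abs_le_iff)
    moreover have "0 \<le> \<epsilon> * (norm u)\<^sup>2"
      using eps_pos by simp
    ultimately have "v \<bullet> (target *v v) < c * (norm v)\<^sup>2"
      using x unfolding gadget_quadratic_form norm_slack[of x] v_def[symmetric] u_def[symmetric]
        w_def[symmetric]
      by (simp add: algebra_simps)
    then show "slack_component False x \<bullet> (target *v slack_component False x)
        < c * (norm (slack_component False x))\<^sup>2"
      by (simp add: v_def)
  qed (use j in auto)
  then show False by (simp add: c_def)
qed

end

end

theorem mainTheorem12:
  fixes H_else :: "'q::finite set cmatrix"
    and S T :: "'q set"
    and A B :: "'q local_op"
    and \<alpha> \<epsilon> \<Delta> :: real
  assumes "hermitian H_else"
    and "S \<inter> T = {}"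
    and "hermitian (extend S A)"
    and "hermitian (extend T B)"
    and "op_norm (extend S A) = 1"
    and "op_norm (extend T B) = 1"
    and "\<epsilon> > 0"
    and "\<Delta> > 0"
    and "\<Delta> \<ge> (2 * \<bar>\<alpha>\<bar> / \<epsilon> + 1) * (2 * op_norm H_else + \<bar>\<alpha>\<bar> + \<epsilon>)"
  shows "\<forall>j\<in>{1..2 ^ CARD('q)}.
    \<bar>nth_smallest_eigenvalue j (H_gadget H_else \<alpha> \<Delta> S T A B)
      - nth_smallest_eigenvalue j (H_target H_else \<alpha> S T A B)\<bar> \<le> \<epsilon>"
proof
  interpret subdivision_gadget H_else S T A B \<alpha> \<Delta>
    using assms by unfold_locales
  fix j :: nat assume "j \<in> {1..2 ^ CARD('q)}"
  then have j: "j \<in> {1..CARD('q set)}" by simp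
  have "nth_smallest_eigenvalue j gadget - \<epsilon> \<le> nth_smallest_eigenvalue j target"
  \<comment> \<open>The upper bound is available for every \<open>c\<close> strictly above the
    target eigenvalue; letting \<open>c\<close> decrease to it gives the non-strict
    inequality.\<close>
  proof (rule dense_ge)
    fix c assume "nth_smallest_eigenvalue j target < c"
    from gadget_eigenvalue_upper[OF assms(7) refl assms(9) j this]
    show "nth_smallest_eigenvalue j gadget - \<epsilon> \<le> c" by simp
  qed
  with gadget_eigenvalue_lower[OF assms(7) refl assms(9) j]
  show "\<bar>nth_smallest_eigenvalue j gadget - nth_smallest_eigenvalue j target\<bar> \<le> \<epsilon>"
    by (simp add: abs_le_iff)
qed

end
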